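(* Let $n\ge 1$ be an integer, let $I\subset[0,\infty)$ be an interval, and let $f:I\to\mathbb{R}$ be an $n$-times differentiable function on $I^\circ$ such that $f^{(n)}\in L^1[a,b]$, where $a,b\in I$, $a<b$. Let $p,q$ be conjugate numbers where $q\ge 1$ and $p=\frac{q}{q-1}$. If $|f^{(n)}|^q$ is $s$-convex (in the second sense) on $[a,b]$ for some fixed $s\in(0,1]$, then for every $\lambda\in[a,b]$, $$\left|\sum_{m=1}^n(-1)^{n-m+2}\left[\frac{(\lambda-a)^m-(\lambda-b)^m}{m!}\right]f^{(m-1)}(\lambda)+(-1)^n\int_a^b f(x)\,dx\right|$$ $$\le\frac{(np+1)^{-\frac1p}}{n!}\left(\frac{1}{s+1}\right)^{\frac1q}\left[(\lambda-a)^{n+1}\left(|f^{(n)}(a)|^q+|f^{(n)}(\lambda)|^q\right)^{\frac1q}+(b-\lambda)^{n+1}\left(|f^{(n)}(b)|^q+|f^{(n)}(\lambda)|^q\right)^{\frac1q}\right].$$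
   Context: $I^\circ$ denotes the interior of $I$. A real function $g$ on $[a,b]\subset[0,\infty)$ is $s$-convex (in the second sense), $s\in(0,1]$, if $g(tx+(1-t)y)\le t^s g(x)+(1-t)^s g(y)$ for all $x,y\in[a,b]$ and $t\in[0,1]$. It is understood that $f$ is $n$ times differentiable at every point of $[a,b]$ (one-sided at a point that is an endpoint of $I$), so that $f^{(n)}$ is defined on all of $[a,b]$; $f^{(0)}=f$. When $q=1$ (so $p=\infty$), the factor $(np+1)^{-1/p}$ is read as its limit $1$. *)

theory Defs
  imports "HOL-Analysis.Analysis"
begin

text \<open>
  The derivative relative to a set: with \<open>I\<close> an interval it is the ordinary derivative at interior
  points of \<open>I\<close> and the one-sided derivative at an endpoint that belongs to \<open>I\<close>. The library's
  \<^const>\<open>deriv\<close> is the case \<open>I = UNIV\<close>. Thus \<open>(deriv_within I ^^ k) f\<close> is the \<open>k\<close>-th derivative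
  of \<open>f\<close>, which is meaningful at those points where the derivatives of lower order are
  differentiable.
\<close>

definition deriv_within :: "real set \<Rightarrow> (real \<Rightarrow> real) \<Rightarrow> real \<Rightarrow> real" where
  "deriv_within I f x = (SOME D. (f has_real_derivative D) (at x within I))"

lemma deriv_within_UNIV: "deriv_within UNIV f = deriv f"
  by (rule ext) (simp only: deriv_within_def deriv_def)

lemma deriv_within_interior: "x \<in> interior I \<Longrightarrow> deriv_within I f x = deriv f x"
  by (simp only: deriv_within_def deriv_def at_within_interior)

lemma funpow_deriv_within_interior:
  "x \<in> interior I \<Longrightarrow> (deriv_within I ^^ k) f x = (deriv ^^ k) f x"
proof (induction k arbitrary: x)
  case (Suc k)
  have "\<forall>\<^sub>F y in nhds x. (deriv_within I ^^ k) f y = (deriv ^^ k) f y"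
    using eventually_nhds_in_open[OF open_interior Suc.prems]
    by (rule eventually_mono) (rule Suc.IH)
  from deriv_cong_ev[OF this refl] show ?case
    by (simp add: deriv_within_interior[OF Suc.prems])
qed simp

lemma deriv_within_eqI:
  assumes "is_interval I" "x \<in> I" "y \<in> I" "y \<noteq> x"
    and "(f has_real_derivative D) (at x within I)"
  shows "deriv_within I f x = D"
proof -
  have "connected I"
    using assms(1) by (simp add: is_interval_connected)
  moreover have "I \<noteq> {z}" for z
    using assms(2-4) by blast
  ultimately have "x islimpt I"
    using assms(2) by (intro connected_imp_perfect)
  then have nontriv: "at x within I \<noteq> bot"
    by (simp add: trivial_limit_within)
  have "(f has_real_derivative deriv_within I f x) (at x within I)"
    unfolding deriv_within_def using assms(5) by (rule someI)
  then show ?thesis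
    by (intro vector_derivative_unique_within[OF nontriv,
          OF _ assms(5)[unfolded has_real_derivative_iff_has_vector_derivative]])
      (simp only: has_real_derivative_iff_has_vector_derivative)
qed

text \<open>Convexity in the second sense, meant for \<open>S \<subseteq> {0..}\<close> convex and \<open>0 < s \<le> 1\<close>. Since
  \<open>0 powr s = 0\<close>, the cases \<open>t = 0\<close> and \<open>t = 1\<close> agree with the convention \<open>0\<^sup>s = 0\<close>.\<close>

definition s_convex_on :: "real \<Rightarrow> real set \<Rightarrow> (real \<Rightarrow> real) \<Rightarrow> bool" where
  "s_convex_on s S g \<longleftrightarrow>
     (\<forall>x\<in>S. \<forall>y\<in>S. \<forall>t\<in>{0..1}. g (t * x + (1 - t) * y) \<le> t powr s * g x + (1 - t) powr s * g y)"

end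

theory Submission
  imports Defs
begin

text \<open>
  Write \<open>D k\<close> for the \<open>k\<close>-th derivative of \<open>f\<close>. Integrating \<open>(x - a)\<^sup>n / n! * D n x\<close> by parts
  \<open>n\<close> times over \<open>[a, l]\<close> leaves boundary terms at \<open>l\<close> only, since the powers of \<open>x - a\<close> vanish
  at \<open>a\<close>, and the final term \<open>(-1)\<^sup>n\<close> times the integral of \<open>f\<close>. The same over \<open>[l, b]\<close> with
  \<open>(x - b)\<^sup>n / n!\<close> again leaves boundary terms at \<open>l\<close> only, with the opposite sign. The expression
  to be estimated is thus exactly the sum of these two integrals
  (\<open>has_integral_power_times_derivative\<close>).

  Each integral is then bounded on its own (\<open>integral_power_times_s_convex_le\<close>). On an interval of
  length \<open>L\<close>, with the weight normalised to \<open>w = \<bar>x - c\<bar> / L\<close>, the powers \<open>w\<^sup>n\<^sup>p\<close> integrate to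
  \<open>L / (n p + 1)\<close>, while s-convexity puts \<open>\<bar>D n\<bar>\<^sup>q\<close> below
  a combination of its two endpoint values, with coefficients the \<open>s\<close>-th powers of the barycentric
  coordinates; each coefficient integrates to \<open>L / (s + 1)\<close>. Hoelder's inequality
  (\<open>Hoelder_integral_majorant\<close>) joins the two, and the factors \<open>L\<^sup>n\<close> and
  \<open>L\<^sup>1\<^sup>/\<^sup>p * L\<^sup>1\<^sup>/\<^sup>q = L\<close> give the power \<open>n + 1\<close>. For \<open>q = 1\<close> the bound
  \<open>w \<le> 1\<close> replaces Hoelder's inequality.
\<close>

section \<open>Repeated integration by parts against a power\<close>

lemma has_real_derivative_deriv_within:
  assumes "f differentiable (at x within I)"
  shows "(f has_real_derivative deriv_within I f x) (at x within I)"
  using assms unfolding deriv_within_def real_differentiable_def by (rule someI_ex)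

text \<open>
  An explicit antiderivative of \<open>(x - c)\<^sup>n / n! * D n x\<close>. Passing from \<open>n\<close> to \<open>n + 1\<close> turns the
  antiderivative \<open>R\<close> into \<open>(y - c)\<^sup>n\<^sup>+\<^sup>1 / (n + 1)! * D n y - R y\<close>, which is one integration by
  parts: the first half of the product rule cancels against the derivative of \<open>R\<close>. Since
  \<open>D n\<close> may be discontinuous, it is this antiderivative that makes the product
  Henstock-Kurzweil integrable.
\<close>

lemma has_real_derivative_by_parts_sum:
  fixes D :: "nat \<Rightarrow> real \<Rightarrow> real" and \<Phi> :: "real \<Rightarrow> real" and c :: real
  assumes \<Phi>: "(\<Phi> has_real_derivative D 0 x) (at x within S)"
    and D: "\<And>k. k < n \<Longrightarrow> (D k has_real_derivative D (Suc k) x) (at x within S)"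
  shows "((\<lambda>y. (\<Sum>m=1..n. (-1) ^ (n - m) * ((y - c) ^ m / fact m) * D (m - 1) y) + (-1) ^ n * \<Phi> y)
           has_real_derivative (x - c) ^ n / fact n * D n x) (at x within S)"
  using D
proof (induction n)
  case 0
  show ?case using \<Phi> by simp
next
  case (Suc n)
  let ?R = "\<lambda>n y. (\<Sum>m=1..n. (-1) ^ (n - m) * ((y - c) ^ m / fact m) * D (m - 1) y) + (-1) ^ n * \<Phi> y"
  have rec: "?R (Suc n) = (\<lambda>y. (y - c) ^ Suc n / fact (Suc n) * D n y - ?R n y)"
  proof
    fix y
    have "(\<Sum>m=1..n. (-1) ^ (Suc n - m) * ((y - c) ^ m / fact m) * D (m - 1) y)
        = - (\<Sum>m=1..n. (-1) ^ (n - m) * ((y - c) ^ m / fact m) * D (m - 1) y)"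
      unfolding sum_negf[symmetric] by (rule sum.cong) (auto simp: Suc_diff_le)
    then show "?R (Suc n) y = (y - c) ^ Suc n / fact (Suc n) * D n y - ?R n y"
      by simp
  qed
  have pow: "((\<lambda>y. (y - c) ^ Suc n / fact (Suc n)) has_real_derivative (x - c) ^ n / fact n) (at x within S)"
    by (rule derivative_eq_intros refl | simp)+
  have IH: "(?R n has_real_derivative (x - c) ^ n / fact n * D n x) (at x within S)"
    using Suc by simp
  show ?case
    unfolding rec
    by (rule DERIV_cong[OF DERIV_diff[OF DERIV_mult[OF pow Suc.prems[OF lessI]] IH]]) simp
qed

lemma has_integral_power_times_derivative:
  fixes D :: "nat \<Rightarrow> real \<Rightarrow> real" and c u v :: real
  assumes "u \<le> v" and "n \<ge> 1"
    and D: "\<And>k x. k < n \<Longrightarrow> x \<in> {u..v} \<Longrightarrow> (D k has_real_derivative D (Suc k) x) (at x within {u..v})"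
  shows "((\<lambda>x. (x - c) ^ n / fact n * D n x) has_integral
            (\<Sum>m=1..n. (-1) ^ (n - m) * ((v - c) ^ m / fact m) * D (m - 1) v)
          - (\<Sum>m=1..n. (-1) ^ (n - m) * ((u - c) ^ m / fact m) * D (m - 1) u)
          + (-1) ^ n * integral {u..v} (D 0)) {u..v}"
proof -
  let ?R = "\<lambda>y. (\<Sum>m=1..n. (-1) ^ (n - m) * ((y - c) ^ m / fact m) * D (m - 1) y)
                 + (-1) ^ n * integral {u..y} (D 0)"
  have "continuous_on {u..v} (D 0)"
    using D[of 0] \<open>n \<ge> 1\<close> by (intro DERIV_continuous_on) auto
  then have \<Phi>: "((\<lambda>y. integral {u..y} (D 0)) has_real_derivative D 0 x) (at x within {u..v})"
    if "x \<in> {u..v}" for x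
    using that by (rule integral_has_real_derivative)
  have "(?R has_vector_derivative (x - c) ^ n / fact n * D n x) (at x within {u..v})"
    if "x \<in> {u..v}" for x
    unfolding has_real_derivative_iff_has_vector_derivative[symmetric]
    using \<Phi> D that by (intro has_real_derivative_by_parts_sum) auto
  from fundamental_theorem_of_calculus[OF \<open>u \<le> v\<close> this] show ?thesis
    by (simp add: algebra_simps)
qed

section \<open>Hoelder's inequality with a majorant\<close>

text \<open>
  Normalise \<open>f\<close> and \<open>g\<close> by the two factors on the right, apply Young's inequality pointwise, and
  integrate. The function \<open>h\<close> stands in for \<open>\<bar>g\<bar>\<^sup>q\<close>, so that neither \<open>\<bar>g\<bar>\<^sup>q\<close> nor \<open>\<bar>f * g\<bar>\<close> has
  to be integrable.
\<close>

lemma Hoelder_integral_majorant: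
  fixes f g h :: "real \<Rightarrow> real"
  assumes p: "p > 1" and q: "q > 1" and pq: "1 / p + 1 / q = 1"
    and fg: "(\<lambda>x. f x * g x) integrable_on S"
    and A: "((\<lambda>x. \<bar>f x\<bar> powr p) has_integral A) S"
    and H: "(h has_integral H) S"
    and h: "\<And>x. x \<in> S \<Longrightarrow> \<bar>g x\<bar> powr q \<le> h x"
  shows "\<bar>integral S (\<lambda>x. f x * g x)\<bar> \<le> A powr (1 / p) * H powr (1 / q)"
proof -
  have A0: "A \<ge> 0" using has_integral_nonneg[OF A] by simp
  have H0: "H \<ge> 0" by (rule has_integral_nonneg[OF H]) (use h in \<open>auto intro: order_trans[OF powr_ge_zero]\<close>)
  \<comment> \<open>Adding \<open>e\<close> makes the normalising factors positive even when \<open>A\<close> or \<open>H\<close> vanishes; \<open>e\<close> tends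
    to \<open>0\<close> at the end.\<close>
  have bound: "\<bar>integral S (\<lambda>x. f x * g x)\<bar> \<le> (A + e) powr (1 / p) * (H + e) powr (1 / q)"
    if "e > 0" for e
  proof -
    let ?\<alpha> = "(A + e) powr (1 / p)" and ?\<beta> = "(H + e) powr (1 / q)"
    have pos: "?\<alpha> > 0" "?\<beta> > 0" using A0 H0 \<open>e > 0\<close> by auto
    have \<alpha>p: "?\<alpha> powr p = A + e" and \<beta>q: "?\<beta> powr q = H + e"
      using A0 H0 \<open>e > 0\<close> p q by (auto simp: powr_powr)
    let ?y = "\<lambda>x. ?\<alpha> * ?\<beta> * (\<bar>f x\<bar> powr p / (p * (A + e)) + h x / (q * (H + e)))"
    let ?Y = "?\<alpha> * ?\<beta> * (A / (p * (A + e)) + H / (q * (H + e)))"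
    have int: "(?y has_integral ?Y) S"
      by (intro has_integral_mult_right has_integral_add has_integral_divide A H)
    have "norm (f x * g x) \<le> ?y x" if "x \<in> S" for x
    proof -
      have "\<bar>f x\<bar> / ?\<alpha> * (\<bar>g x\<bar> / ?\<beta>) \<le> (\<bar>f x\<bar> / ?\<alpha>) powr p / p + (\<bar>g x\<bar> / ?\<beta>) powr q / q"
        using pos by (intro Youngs_inequality p q pq) auto
      also have "\<dots> = \<bar>f x\<bar> powr p / (p * (A + e)) + \<bar>g x\<bar> powr q / (q * (H + e))"
        using pos by (simp add: powr_divide \<alpha>p \<beta>q mult.commute)
      also have "\<dots> \<le> \<bar>f x\<bar> powr p / (p * (A + e)) + h x / (q * (H + e))"
        using h[OF that] H0 \<open>e > 0\<close> q by (intro add_left_mono divide_right_mono) auto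
      finally show ?thesis
        using pos by (simp add: abs_mult field_simps)
    qed
    then have "norm (integral S (\<lambda>x. f x * g x)) \<le> integral S ?y"
      using int by (intro integral_norm_bound_integral fg) (auto simp: integrable_on_def)
    also have "\<dots> = ?Y" using int by (rule integral_unique)
    also have "\<dots> \<le> ?\<alpha> * ?\<beta> * (1 / p + 1 / q)"
    proof -
      have "A / (p * (A + e)) \<le> 1 / p" "H / (q * (H + e)) \<le> 1 / q"
        using A0 H0 \<open>e > 0\<close> p q by (auto simp: divide_simps)
      then show ?thesis using pos by (intro mult_left_mono add_mono) auto
    qed
    finally show ?thesis using pq by simp
  qed
  have "((\<lambda>e. (A + e) powr (1 / p) * (H + e) powr (1 / q))
          \<longlongrightarrow> (A + 0) powr (1 / p) * (H + 0) powr (1 / q)) (at_right 0)"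
    using p q A0 H0
    by (intro tendsto_intros tendsto_powr') (auto simp: eventually_at_right_less intro!: eventually_at_rightI[of 0 1])
  moreover have "\<forall>\<^sub>F e in at_right 0. \<bar>integral S (\<lambda>x. f x * g x)\<bar> \<le> (A + e) powr (1 / p) * (H + e) powr (1 / q)"
    using bound by (intro eventually_at_rightI[of 0 1]) auto
  ultimately show ?thesis
    by (auto intro: tendsto_lowerbound)
qed

section \<open>Powers and s-convex functions on an interval\<close>

lemma has_integral_powr_ramp_up:
  fixes u v r :: real
  assumes "u < v" and "r > 0"
  shows "((\<lambda>x. ((x - u) / (v - u)) powr r) has_integral (v - u) / (r + 1)) {u..v}"
proof -
  let ?G = "\<lambda>x. (v - u) / (r + 1) * ((x - u) / (v - u)) powr (r + 1)"
  have "((\<lambda>x. ((x - u) / (v - u)) powr r) has_integral ?G v - ?G u) {u..v}"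
  proof (rule fundamental_theorem_of_calculus_interior)
    show "continuous_on {u..v} ?G"
      using assms by (intro continuous_intros continuous_on_powr') auto
    fix x assume "x \<in> {u<..<v}"
    then have "(?G has_real_derivative ((x - u) / (v - u)) powr r) (at x)"
      using assms by (auto intro!: derivative_eq_intros)
    then show "(?G has_vector_derivative ((x - u) / (v - u)) powr r) (at x)"
      by (simp add: has_real_derivative_iff_has_vector_derivative)
  qed (use assms in simp)
  then show ?thesis using assms by simp
qed

lemma has_integral_powr_ramp_down:
  fixes u v r :: real
  assumes "u < v" and "r > 0"
  shows "((\<lambda>x. ((v - x) / (v - u)) powr r) has_integral (v - u) / (r + 1)) {u..v}"
  using has_integral_reflect_real[THEN iffD2, OF has_integral_powr_ramp_up[of "- v" "- u" r]] assms
  by (simp add: algebra_simps)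

text \<open>
  s-convexity read at the barycentric coordinates of \<open>x\<close> in \<open>[u, v]\<close>: the resulting majorant is an
  explicit function of \<open>x\<close>, integrable whatever \<open>g\<close> is.
\<close>

lemma s_convex_on_le_endpoints:
  assumes "s_convex_on s {u..v} g" and "u < v" and "x \<in> {u..v}"
  shows "g x \<le> ((v - x) / (v - u)) powr s * g u + ((x - u) / (v - u)) powr s * g v"
proof -
  define t where "t = (v - x) / (v - u)"
  have t: "t \<in> {0..1}" "1 - t = (x - u) / (v - u)"
    using assms by (auto simp: t_def field_simps)
  have "t * u + (1 - t) * v = v - t * (v - u)" by (simp add: algebra_simps)
  also have "\<dots> = x" using assms by (simp add: t_def)
  finally have x: "t * u + (1 - t) * v = x" .
  have "u \<in> {u..v}" "v \<in> {u..v}" using assms by auto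
  with assms(1) t(1) have "g (t * u + (1 - t) * v) \<le> t powr s * g u + (1 - t) powr s * g v"
    unfolding s_convex_on_def by blast
  then show ?thesis unfolding x unfolding t(2) unfolding t_def .
qed

lemma s_convex_on_subset:
  "s_convex_on s T g \<Longrightarrow> S \<subseteq> T \<Longrightarrow> s_convex_on s S g"
  unfolding s_convex_on_def by blast

lemma has_integral_s_convex_majorant:
  fixes u v s A B :: real
  assumes "u < v" and "s > 0"
  shows "((\<lambda>x. ((v - x) / (v - u)) powr s * A + ((x - u) / (v - u)) powr s * B)
           has_integral (v - u) * (A + B) / (s + 1)) {u..v}"
  by (rule has_integral_eq_rhs[OF has_integral_add[OF
        has_integral_mult_left[OF has_integral_powr_ramp_down[OF assms]]
        has_integral_mult_left[OF has_integral_powr_ramp_up[OF assms]]]])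
     (simp add: add_divide_distrib distrib_left mult.commute)

section \<open>Powers against functions with an s-convex power\<close>

text \<open>
  The centre \<open>c\<close> may be either endpoint, and the bound is the same for both: \<open>\<bar>x - c\<bar>\<close> runs linearly
  between \<open>0\<close> and the length of the interval in each case. The two halves \<open>[a, l]\<close> and \<open>[l, b]\<close>
  of the theorem are the cases \<open>c = u\<close> and \<open>c = v\<close>.
\<close>

lemma integral_power_times_s_convex_le:
  fixes F :: "real \<Rightarrow> real" and u v c p q s :: real
  assumes "u \<le> v" and c: "c = u \<or> c = v" and "n \<ge> 1"
    and "q \<ge> 1" and p: "p = q / (q - 1)" and "s > 0"
    and cvx: "s_convex_on s {u..v} (\<lambda>x. \<bar>F x\<bar> powr q)"
    and int: "(\<lambda>x. (x - c) ^ n / fact n * F x) integrable_on {u..v}"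
  shows "\<bar>integral {u..v} (\<lambda>x. (x - c) ^ n / fact n * F x)\<bar>
           \<le> (if q = 1 then 1 else (real n * p + 1) powr (- (1 / p))) / fact n
              * (1 / (s + 1)) powr (1 / q)
              * ((v - u) ^ (n + 1) * (\<bar>F u\<bar> powr q + \<bar>F v\<bar> powr q) powr (1 / q))"
proof (cases "u = v")
  case True
  then show ?thesis by simp
next
  case False
  with \<open>u \<le> v\<close> have uv: "u < v" by simp
  define L where "L = v - u"
  \<comment> \<open>The weight scaled to absolute value at most \<open>1\<close>, so that the integrals of its powers and of
    \<open>h\<close> are both \<open>L\<close> times a constant.\<close>
  define w where "w = (\<lambda>x. (x - c) / L)"
  define h where "h = (\<lambda>x. ((v - x) / (v - u)) powr s * \<bar>F u\<bar> powr q + ((x - u) / (v - u)) powr s * \<bar>F v\<bar> powr q)"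
  define Q where "Q = (\<bar>F u\<bar> powr q + \<bar>F v\<bar> powr q) / (s + 1)"
  have L: "L > 0" and Q: "Q \<ge> 0" using uv \<open>s > 0\<close> by (auto simp: L_def Q_def)
  have h: "\<bar>F x\<bar> powr q \<le> h x" if "x \<in> {u..v}" for x
    unfolding h_def using s_convex_on_le_endpoints[OF cvx uv that] .
  have int_h: "(h has_integral L * Q) {u..v}"
    using has_integral_s_convex_majorant[OF uv \<open>s > 0\<close>] by (simp add: h_def L_def Q_def)
  have kernel: "(x - c) ^ n / fact n * F x = L ^ n / fact n * (w x ^ n * F x)" for x
    using L by (simp add: w_def power_divide)
  have int_w: "(\<lambda>x. w x ^ n * F x) integrable_on {u..v}"
    using integrable_cmul[OF int[unfolded kernel], of "fact n / L ^ n"] L by simp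
  have "\<bar>integral {u..v} (\<lambda>x. w x ^ n * F x)\<bar>
          \<le> (if q = 1 then 1 else (real n * p + 1) powr (- (1 / p))) * L * Q powr (1 / q)"
  proof (cases "q = 1")
    case True
    have "norm (w x ^ n * F x) \<le> h x" if "x \<in> {u..v}" for x
    proof -
      have "\<bar>w x\<bar> \<le> 1" using that c L by (auto simp: w_def L_def abs_if field_simps)
      then have "\<bar>w x\<bar> ^ n * \<bar>F x\<bar> \<le> 1 * \<bar>F x\<bar>"
        by (intro mult_right_mono power_le_one) auto
      then show ?thesis using h[OF that] True by (simp add: abs_mult power_abs)
    qed
    then have "norm (integral {u..v} (\<lambda>x. w x ^ n * F x)) \<le> integral {u..v} h"
      using int_h by (intro integral_norm_bound_integral int_w) (auto simp: integrable_on_def)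
    then show ?thesis using True int_h Q L by (simp add: integral_unique)
  next
    case False
    with \<open>q \<ge> 1\<close> have q: "q > 1" by simp
    have p1: "p > 1" and pq: "1 / p + 1 / q = 1" using q by (auto simp: p field_simps)
    define r where "r = real n * p"
    have r: "r > 0" using p1 \<open>n \<ge> 1\<close> by (simp add: r_def)
    have "((\<lambda>x. \<bar>w x\<bar> powr r) has_integral L / (r + 1)) {u..v}"
      using c
    proof
      assume "c = u"
      show ?thesis
        by (rule has_integral_eq[OF _ has_integral_powr_ramp_up[OF uv r, folded L_def]])
           (use L \<open>c = u\<close> in \<open>auto simp: w_def\<close>)
    next
      assume "c = v"
      show ?thesis
        by (rule has_integral_eq[OF _ has_integral_powr_ramp_down[OF uv r, folded L_def]])
           (use L \<open>c = v\<close> in \<open>auto simp: w_def\<close>)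
    qed
    moreover have "\<bar>w x ^ n\<bar> powr p = \<bar>w x\<bar> powr r" for x
      using \<open>n \<ge> 1\<close> p1 by (cases "w x = 0") (auto simp: r_def power_abs powr_powr simp flip: powr_realpow)
    ultimately have A: "((\<lambda>x. \<bar>w x ^ n\<bar> powr p) has_integral L / (r + 1)) {u..v}"
      by simp
    have "\<bar>integral {u..v} (\<lambda>x. w x ^ n * F x)\<bar> \<le> (L / (r + 1)) powr (1 / p) * (L * Q) powr (1 / q)"
      by (rule Hoelder_integral_majorant[OF p1 q pq int_w A int_h h])
    also have "\<dots> = (r + 1) powr (- (1 / p)) * (L powr (1 / p) * L powr (1 / q)) * Q powr (1 / q)"
      using L Q r by (simp add: powr_divide powr_mult powr_minus_divide)
    also have "L powr (1 / p) * L powr (1 / q) = L"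
      using L pq by (simp add: powr_add[symmetric])
    finally show ?thesis using False by (simp add: r_def)
  qed
  then have "L ^ n / fact n * \<bar>integral {u..v} (\<lambda>x. w x ^ n * F x)\<bar>
      \<le> L ^ n / fact n * ((if q = 1 then 1 else (real n * p + 1) powr (- (1 / p))) * L * Q powr (1 / q))"
    using L by (intro mult_left_mono) auto
  moreover have "Q powr (1 / q) = (1 / (s + 1)) powr (1 / q) * (\<bar>F u\<bar> powr q + \<bar>F v\<bar> powr q) powr (1 / q)"
    using \<open>s > 0\<close> by (simp add: Q_def powr_divide)
  ultimately show ?thesis
    using L unfolding kernel integral_mult_right by (simp add: abs_mult L_def mult_ac)
qed

theorem theorem5:
  fixes n :: nat and I :: "real set" and f :: "real \<Rightarrow> real" and a b p q s l :: real
  assumes "n \<ge> 1"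
    and "is_interval I" and "I \<subseteq> {0..}"
    and "a \<in> I" and "b \<in> I" and "a < b"
    and "\<And>k x. k < n \<Longrightarrow> x \<in> interior I \<Longrightarrow>
           (deriv_within I ^^ k) f differentiable (at x)"
    and "\<And>k x. k < n \<Longrightarrow> x \<in> {a..b} \<Longrightarrow>
           (deriv_within I ^^ k) f differentiable (at x within I)"
    and "(deriv_within I ^^ n) f absolutely_integrable_on {a..b}"
    and "q \<ge> 1" and "p = q / (q - 1)"
    and "0 < s" and "s \<le> 1"
    and "s_convex_on s {a..b} (\<lambda>x. \<bar>(deriv_within I ^^ n) f x\<bar> powr q)"
    and "l \<in> {a..b}"
  shows "\<bar>(\<Sum>m=1..n. (-1) ^ (n - m + 2) * (((l - a) ^ m - (l - b) ^ m) / fact m)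
              * (deriv_within I ^^ (m - 1)) f l)
           + (-1) ^ n * integral {a..b} f\<bar>
         \<le> (if q = 1 then 1 else (real n * p + 1) powr (- (1 / p))) / fact n
             * (1 / (s + 1)) powr (1 / q)
             * ((l - a) ^ (n + 1)
                  * (\<bar>(deriv_within I ^^ n) f a\<bar> powr q + \<bar>(deriv_within I ^^ n) f l\<bar> powr q) powr (1 / q)
              + (b - l) ^ (n + 1)
                  * (\<bar>(deriv_within I ^^ n) f b\<bar> powr q + \<bar>(deriv_within I ^^ n) f l\<bar> powr q) powr (1 / q))"
proof -
  let ?D = "\<lambda>k. (deriv_within I ^^ k) f"
  let ?S = "\<lambda>c. \<Sum>m=1..n. (-1) ^ (n - m) * ((l - c) ^ m / fact m) * ?D (m - 1) l"
  let ?K = "\<lambda>c x. (x - c) ^ n / fact n * ?D n x"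
  let ?C = "(if q = 1 then 1 else (real n * p + 1) powr (- (1 / p))) / fact n * (1 / (s + 1)) powr (1 / q)"
  have l: "a \<le> l" "l \<le> b" using \<open>l \<in> {a..b}\<close> by auto
  have abI: "{a..b} \<subseteq> I"
    using \<open>is_interval I\<close> \<open>a \<in> I\<close> \<open>b \<in> I\<close> by (meson atLeastAtMost_iff mem_is_interval_1_I subsetI)
  have D: "(?D k has_real_derivative ?D (Suc k) x) (at x within {u..v})"
    if "k < n" "x \<in> {u..v}" "{u..v} \<subseteq> {a..b}" for k x u v
  proof (rule has_field_derivative_subset)
    show "{u..v} \<subseteq> I" using that abI by blast
    show "(?D k has_real_derivative ?D (Suc k) x) (at x within I)"
      using has_real_derivative_deriv_within[OF assms(8)] that by auto
  qed
  have "?D 0 differentiable (at x within {a..b})" if "x \<in> {a..b}" for x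
    using D[of 0 x a b] that \<open>n \<ge> 1\<close> real_differentiable_def by auto
  then have "continuous_on {a..b} f"
    by (intro differentiable_imp_continuous_on) (simp add: differentiable_on_def)
  then have split: "integral {a..b} f = integral {a..l} f + integral {l..b} f"
    using l by (intro Henstock_Kurzweil_Integration.integral_combine[symmetric] integrable_continuous_real) auto
  \<comment> \<open>For \<open>m \<ge> 1\<close> the boundary terms at the centre of the power vanish, so only those at \<open>l\<close>
    survive.\<close>
  have left: "(?K a has_integral ?S a + (-1) ^ n * integral {a..l} f) {a..l}"
    using has_integral_power_times_derivative[of a l n ?D a] D[of _ _ a l] l \<open>n \<ge> 1\<close>
    by (simp add: zero_power)
  have right: "(?K b has_integral - ?S b + (-1) ^ n * integral {l..b} f) {l..b}"
    using has_integral_power_times_derivative[of l b n ?D b] D[of _ _ l b] l \<open>n \<ge> 1\<close>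
    by (simp add: zero_power)
  have sign: "(-1) ^ (n - m + 2) = ((-1) ^ (n - m) :: real)" for m
    by simp
  have "(\<Sum>m=1..n. (-1) ^ (n - m + 2) * (((l - a) ^ m - (l - b) ^ m) / fact m) * ?D (m - 1) l)
      = ?S a - ?S b"
    unfolding sign sum_subtractf[symmetric] by (rule sum.cong) (simp_all add: algebra_simps diff_divide_distrib)
  then have identity: "(\<Sum>m=1..n. (-1) ^ (n - m + 2) * (((l - a) ^ m - (l - b) ^ m) / fact m) * ?D (m - 1) l)
        + (-1) ^ n * integral {a..b} f
      = integral {a..l} (?K a) + integral {l..b} (?K b)"
    using integral_unique[OF left] integral_unique[OF right] by (simp add: split algebra_simps)
  note half = integral_power_times_s_convex_le[OF _ _ \<open>n \<ge> 1\<close> \<open>q \<ge> 1\<close> \<open>p = q / (q - 1)\<close> \<open>0 < s\<close>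
      s_convex_on_subset[OF assms(14)]]
  have "\<bar>integral {a..l} (?K a)\<bar>
      \<le> ?C * ((l - a) ^ (n + 1) * (\<bar>?D n a\<bar> powr q + \<bar>?D n l\<bar> powr q) powr (1 / q))"
    using l left by (intro half) (auto simp: integrable_on_def)
  moreover have "\<bar>integral {l..b} (?K b)\<bar>
      \<le> ?C * ((b - l) ^ (n + 1) * (\<bar>?D n l\<bar> powr q + \<bar>?D n b\<bar> powr q) powr (1 / q))"
    using l right by (intro half) (auto simp: integrable_on_def)
  ultimately show ?thesis
    unfolding identity distrib_left
    by (intro order_trans[OF abs_triangle_ineq] add_mono) (simp_all only: add.commute)
qed

end
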